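(* Consider an exponential family $p(x|\theta)=e^{\theta\cdot h(x)+k(x)-\psi(\theta)}$ with two-dimensional parameter $\theta=(\theta_1,\theta_2)$ ranging over an open set $\Theta\subseteq\mathbb{R}^2$, with $\psi$ smooth, whose (non-degenerate) metric tensor is $$g_{ij}(\theta)=\begin{pmatrix} g_{11}(\theta)&g_{12}(\theta)\\ g_{21}(\theta)&g_{22}(\theta)\end{pmatrix}=\begin{pmatrix}\partial_1^2\psi(\theta)&\partial_1\partial_2\psi(\theta)\\ \partial_2\partial_1\psi(\theta)&\partial_2^2\psi(\theta)\end{pmatrix},\qquad \partial_i=\frac{\partial}{\partial\theta_i}.$$ Then for every $\theta\in\Theta$ the curvature is given by $$S(\theta)=\frac{\left|\begin{matrix} g_{11}&\partial_2 g_{11}&\partial_1 g_{11}\\ g_{12}&\partial_2 g_{12}&\partial_1 g_{12}\\ g_{22}&\partial_2 g_{22}&\partial_1 g_{22}\end{matrix}\right|}{4\left|\begin{matrix} g_{11}&g_{12}\\ g_{21}&g_{22}\end{matrix}\right|^2},$$ where $|\cdot|$ denotes the determinant and all entries are evaluated at $\theta$.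
   Context: Exponential family: given functions $h(x)=(h_1(x),h_2(x))$, $k(x)$ and a scalar function $\psi(\theta)$ (the regularization function, which is convex and normalizes the densities), the family consists of the probability densities $p(x|\theta)=e^{\theta\cdot h(x)+k(x)-\psi(\theta)}$ on $x\in\mathbb{R}^m$. Its Fisher metric tensor $g_{ij}(\theta)=\mathbb{E}[-\partial_i\partial_j\log p(x|\theta)]$ equals the Hessian $\partial_i\partial_j\psi(\theta)$. Curvature of a metric tensor $g_{ij}$ in coordinates $x^1,\dots,x^d$ (here $d=2$ and $x^i=\theta_i$; Einstein summation): $\Gamma^i_{jk}=\frac12 g^{il}\left(\frac{\partial g_{lj}}{\partial x^k}+\frac{\partial g_{lk}}{\partial x^j}-\frac{\partial g_{jk}}{\partial x^l}\right)$, $\Gamma^i_{jk,\lambda}=\frac{\partial\Gamma^i_{jk}}{\partial x^\lambda}$, $$S_R=g^{\mu\nu}\left(\Gamma^\lambda_{\mu\nu,\lambda}-\Gamma^\lambda_{\mu\lambda,\nu}+\Gamma^\sigma_{\mu\nu}\Gamma^\lambda_{\lambda\sigma}-\Gamma^\sigma_{\mu\lambda}\Gamma^\lambda_{\nu\sigma}\right),$$ and the curvature is $S=\frac1d S_R=\frac12 S_R$ (for $d=2$ this is the Gaussian curvature). *)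

theory Defs
  imports "HOL-Analysis.Analysis" "HOL-Probability.Probability"
begin

definition partial_deriv :: "'n::finite \<Rightarrow> (real^'n \<Rightarrow> real) \<Rightarrow> real^'n \<Rightarrow> real" where
  "partial_deriv i f x = deriv (\<lambda>t. f (x + t *\<^sub>R axis i 1)) 0"

primrec C_on :: "nat \<Rightarrow> (real^'n::finite) set \<Rightarrow> (real^'n \<Rightarrow> real) \<Rightarrow> bool" where
  "C_on 0 U f \<longleftrightarrow> continuous_on U f"
| "C_on (Suc r) U f \<longleftrightarrow> f differentiable_on U \<and> (\<forall>i. C_on r U (partial_deriv i f))"

text \<open>Meant for open \<open>U\<close> only.\<close>

definition smooth_on :: "(real^'n::finite) set \<Rightarrow> (real^'n \<Rightarrow> real) \<Rightarrow> bool" where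
  "smooth_on U f \<longleftrightarrow> (\<forall>r. C_on r U f)"

definition exp_density ::
    "('x \<Rightarrow> real^'n::finite) \<Rightarrow> ('x \<Rightarrow> real) \<Rightarrow> (real^'n \<Rightarrow> real) \<Rightarrow> real^'n \<Rightarrow> 'x \<Rightarrow> real" where
  "exp_density h k \<psi> \<theta> x = exp (\<theta> \<bullet> h x + k x - \<psi> \<theta>)"

definition exp_measure ::
    "(real^'m::finite \<Rightarrow> real^'n::finite) \<Rightarrow> (real^'m \<Rightarrow> real) \<Rightarrow> (real^'n \<Rightarrow> real) \<Rightarrow> real^'n
      \<Rightarrow> (real^'m) measure" where
  "exp_measure h k \<psi> \<theta> = density lebesgue (\<lambda>x. ennreal (exp_density h k \<psi> \<theta> x))"

text \<open>Convexity of \<open>\<psi>\<close> is not a separate requirement: by Hoelder's inequality it follows from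
  the normalization.\<close>

definition exponential_family ::
    "(real^'n::finite) set \<Rightarrow> (real^'m::finite \<Rightarrow> real^'n) \<Rightarrow> (real^'m \<Rightarrow> real) \<Rightarrow> (real^'n \<Rightarrow> real)
      \<Rightarrow> bool" where
  "exponential_family \<Theta> h k \<psi> \<longleftrightarrow>
     h \<in> borel_measurable lebesgue \<and> k \<in> borel_measurable lebesgue \<and>
     (\<forall>\<theta>\<in>\<Theta>. prob_space (exp_measure h k \<psi> \<theta>))"

definition fisher_metric ::
    "(real^'m::finite \<Rightarrow> real^'n::finite) \<Rightarrow> (real^'m \<Rightarrow> real) \<Rightarrow> (real^'n \<Rightarrow> real)
      \<Rightarrow> real^'n \<Rightarrow> real^'n^'n" where
  "fisher_metric h k \<psi> \<theta> =
     (\<chi> i j. \<integral>x. - partial_deriv i (partial_deriv j (\<lambda>\<eta>. ln (exp_density h k \<psi> \<eta> x))) \<theta>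
        \<partial>exp_measure h k \<psi> \<theta>)"

definition christoffel ::
    "(real^'n::finite \<Rightarrow> real^'n^'n) \<Rightarrow> 'n \<Rightarrow> 'n \<Rightarrow> 'n \<Rightarrow> real^'n \<Rightarrow> real" where
  "christoffel g i j k x = 1/2 * (\<Sum>l\<in>UNIV. matrix_inv (g x) $ i $ l *
     (partial_deriv k (\<lambda>y. g y $ l $ j) x + partial_deriv j (\<lambda>y. g y $ l $ k) x
       - partial_deriv l (\<lambda>y. g y $ j $ k) x))"

definition scalar_curvature :: "(real^'n::finite \<Rightarrow> real^'n^'n) \<Rightarrow> real^'n \<Rightarrow> real" where
  "scalar_curvature g x = (\<Sum>\<mu>\<in>UNIV. \<Sum>\<nu>\<in>UNIV. matrix_inv (g x) $ \<mu> $ \<nu> *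
     ((\<Sum>l\<in>UNIV. partial_deriv l (christoffel g l \<mu> \<nu>) x)
      - (\<Sum>l\<in>UNIV. partial_deriv \<nu> (christoffel g l \<mu> l) x)
      + (\<Sum>s\<in>UNIV. \<Sum>l\<in>UNIV. christoffel g s \<mu> \<nu> x * christoffel g l l s x)
      - (\<Sum>s\<in>UNIV. \<Sum>l\<in>UNIV. christoffel g s \<mu> l x * christoffel g l \<nu> s x)))"

text \<open>The scalar curvature divided by the dimension; in dimension two, the Gaussian curvature.\<close>

definition curvature :: "(real^'n::finite \<Rightarrow> real^'n^'n) \<Rightarrow> real^'n \<Rightarrow> real" where
  "curvature g x = scalar_curvature g x / real CARD('n)"

end

theory Submission
  imports Defs
begin

text \<open>
  The log-density is affine in \<open>\<theta>\<close> up to the term \<open>- \<psi> \<theta>\<close>, so its second derivatives do not depend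
  on the sample point and the Fisher metric is the Hessian of \<open>\<psi>\<close>. For a Hessian metric the
  Christoffel symbols of the first kind are half the totally symmetric third derivatives of \<open>\<psi>\<close>.
  In the curvature the fourth derivatives cancel because partial derivatives commute, and what
  remains is quadratic in the third derivatives: after multiplying the right-hand side by
  \<open>det g / det g\<close> the claim becomes a polynomial identity.
\<close>


section \<open>Calculus of partial derivatives on open sets\<close>

lemma smooth_on_partial_deriv: "smooth_on U f \<Longrightarrow> smooth_on U (partial_deriv i f)"
  unfolding smooth_on_def by (metis C_on.simps(2))

lemma smooth_on_imp_continuous_on: "smooth_on U f \<Longrightarrow> continuous_on U f"
  unfolding smooth_on_def by (metis C_on.simps(1))

text \<open>Only values near the point matter, and a short piece of the line through
  \<open>x\<close> stays in the open set. This allows formulas known only on \<open>U\<close> to be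
  substituted under \<open>partial_deriv\<close>.\<close>

lemma partial_deriv_cong:
  fixes f f' :: "real^'n::finite \<Rightarrow> real"
  assumes "open U" "x \<in> U" "\<And>y. y \<in> U \<Longrightarrow> f y = f' y"
  shows "partial_deriv i f x = partial_deriv i f' x"
proof -
  have "((\<lambda>t. x + t *\<^sub>R axis i 1) \<longlongrightarrow> x + 0 *\<^sub>R axis i 1) (nhds (0::real))"
    by (intro tendsto_intros filterlim_ident)
  then have "\<forall>\<^sub>F t in nhds (0::real). x + t *\<^sub>R axis i 1 \<in> U"
    using assms(1,2) by (auto dest: topological_tendstoD)
  then have "\<forall>\<^sub>F t in nhds 0. f (x + t *\<^sub>R axis i 1) = f' (x + t *\<^sub>R axis i 1)"
    by (rule eventually_mono) (rule assms(3))
  then show ?thesis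
    unfolding partial_deriv_def by (intro deriv_cong_ev) auto
qed

text \<open>Since \<open>deriv\<close> has some value even where no derivative exists, existence
  must be secured: it comes from total differentiability and the chain rule.\<close>

lemma smooth_on_has_partial_deriv:
  fixes f :: "real^'n::finite \<Rightarrow> real"
  assumes "smooth_on U f" "open U" "x \<in> U"
  shows "((\<lambda>t. f (x + t *\<^sub>R axis i 1)) has_real_derivative partial_deriv i f x) (at 0)"
proof -
  have "f differentiable_on U"
    using assms(1) unfolding smooth_on_def by (metis C_on.simps(2))
  then have "f differentiable (at (x + 0 *\<^sub>R axis i 1))"
    using assms(2,3) by (simp add: differentiable_on_eq_differentiable_at)
  moreover have "(\<lambda>t::real. x + t *\<^sub>R axis i 1) differentiable (at 0)"
    by (intro derivative_intros)
  ultimately have "(f \<circ> (\<lambda>t. x + t *\<^sub>R axis i 1)) differentiable (at 0)"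
    by (intro differentiable_chain_at)
  then have "(\<lambda>t. f (x + t *\<^sub>R axis i 1)) field_differentiable (at 0)"
    unfolding o_def real_differentiable_def field_differentiable_def .
  then show ?thesis
    unfolding partial_deriv_def by (simp add: DERIV_deriv_iff_field_differentiable)
qed

section \<open>Symmetry of second derivatives\<close>

lemma smooth_on_has_derivative_along_axis:
  fixes f :: "real^'n::finite \<Rightarrow> real"
  assumes "smooth_on U f" "open U" "x + s *\<^sub>R axis i 1 \<in> U"
  shows "((\<lambda>t. f (x + t *\<^sub>R axis i 1)) has_real_derivative partial_deriv i f (x + s *\<^sub>R axis i 1)) (at s)"
  using smooth_on_has_partial_deriv[OF assms, of i] DERIV_shift[of "\<lambda>t. f (x + t *\<^sub>R axis i 1)" _ 0 s]
  by (simp add: algebra_simps)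

text \<open>Two applications of the mean value theorem: first in direction \<open>i\<close> to the
  increment of \<open>f\<close> in direction \<open>j\<close>, then in direction \<open>j\<close> to
  \<open>partial_deriv i f\<close>. Each contributes one factor \<open>t\<close>.\<close>

lemma second_difference_mvt:
  fixes f :: "real^'n::finite \<Rightarrow> real"
  assumes f: "smooth_on U f" and U: "open U" "ball x e \<subseteq> U" and t: "0 < t" "2 * t < e"
  obtains y where "y \<in> ball x (2 * t)"
    and "f (x + t *\<^sub>R axis i 1 + t *\<^sub>R axis j 1) - f (x + t *\<^sub>R axis i 1) - f (x + t *\<^sub>R axis j 1) + f x
      = t\<^sup>2 * partial_deriv j (partial_deriv i f) y"
proof -
  define u v :: "real^'n" where "u = axis i 1" and "v = axis j 1"
  \<comment> \<open>Axis vectors have norm 1, so the parallelogram spanned by the two steps of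
    length \<open>t\<close> lies within distance \<open>2 * t\<close> of \<open>x\<close>.\<close>
  have near: "dist x (x + s *\<^sub>R u + r *\<^sub>R v) \<le> s + r" if "0 \<le> s" "0 \<le> r" for s r :: real
    using that norm_triangle_ineq[of "- (s *\<^sub>R u)" "- (r *\<^sub>R v)"]
    by (simp add: u_def v_def dist_norm)
  have inU: "x + s *\<^sub>R u + r *\<^sub>R v \<in> U" if "0 \<le> s" "s \<le> t" "0 \<le> r" "r \<le> t" for s r
    using near[of s r] that t U(2) by (auto simp: subset_iff)
  have du: "((\<lambda>s. f (x + s *\<^sub>R u + r *\<^sub>R v)) has_real_derivative partial_deriv i f (x + s *\<^sub>R u + r *\<^sub>R v)) (at s)"
    if "0 \<le> s" "s \<le> t" "0 \<le> r" "r \<le> t" for s r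
    using smooth_on_has_derivative_along_axis[OF f U(1), of "x + r *\<^sub>R v" s i] inU[OF that]
    by (simp add: u_def algebra_simps)
  have dv: "((\<lambda>r. partial_deriv i f (x + s *\<^sub>R u + r *\<^sub>R v)) has_real_derivative
      partial_deriv j (partial_deriv i f) (x + s *\<^sub>R u + r *\<^sub>R v)) (at r)"
    if "0 \<le> s" "s \<le> t" "0 \<le> r" "r \<le> t" for s r
    using smooth_on_has_derivative_along_axis[OF smooth_on_partial_deriv[OF f] U(1), of "x + s *\<^sub>R u" r j i]
      inU[OF that] by (simp add: v_def algebra_simps)
  have "\<exists>s. 0 < s \<and> s < t \<and>
      (f (x + t *\<^sub>R u + t *\<^sub>R v) - f (x + t *\<^sub>R u + 0 *\<^sub>R v)) - (f (x + 0 *\<^sub>R u + t *\<^sub>R v) - f (x + 0 *\<^sub>R u + 0 *\<^sub>R v))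
      = (t - 0) * (partial_deriv i f (x + s *\<^sub>R u + t *\<^sub>R v) - partial_deriv i f (x + s *\<^sub>R u + 0 *\<^sub>R v))"
    by (rule MVT2[OF t(1)], rule DERIV_diff) (use t(1) in \<open>auto intro!: du simp del: scale_zero_left\<close>)
  then obtain s where s: "0 < s" "s < t"
    "(f (x + t *\<^sub>R u + t *\<^sub>R v) - f (x + t *\<^sub>R u + 0 *\<^sub>R v)) - (f (x + 0 *\<^sub>R u + t *\<^sub>R v) - f (x + 0 *\<^sub>R u + 0 *\<^sub>R v))
      = (t - 0) * (partial_deriv i f (x + s *\<^sub>R u + t *\<^sub>R v) - partial_deriv i f (x + s *\<^sub>R u + 0 *\<^sub>R v))"
    by blast
  have "\<exists>r. 0 < r \<and> r < t \<and>
      partial_deriv i f (x + s *\<^sub>R u + t *\<^sub>R v) - partial_deriv i f (x + s *\<^sub>R u + 0 *\<^sub>R v)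
      = (t - 0) * partial_deriv j (partial_deriv i f) (x + s *\<^sub>R u + r *\<^sub>R v)"
    by (rule MVT2[OF t(1)]) (use s(1,2) in \<open>auto intro!: dv\<close>)
  then obtain r where r: "0 < r" "r < t"
    "partial_deriv i f (x + s *\<^sub>R u + t *\<^sub>R v) - partial_deriv i f (x + s *\<^sub>R u + 0 *\<^sub>R v)
      = (t - 0) * partial_deriv j (partial_deriv i f) (x + s *\<^sub>R u + r *\<^sub>R v)"
    by blast
  show thesis
  proof (rule that)
    show "x + s *\<^sub>R u + r *\<^sub>R v \<in> ball x (2 * t)"
      using near[of s r] s r by simp
    show "f (x + t *\<^sub>R axis i 1 + t *\<^sub>R axis j 1) - f (x + t *\<^sub>R axis i 1) - f (x + t *\<^sub>R axis j 1) + f x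
      = t\<^sup>2 * partial_deriv j (partial_deriv i f) (x + s *\<^sub>R u + r *\<^sub>R v)"
      using s(3) r(3) by (simp add: u_def v_def power2_eq_square)
  qed
qed

text \<open>The second difference is symmetric in its two directions, so by the mean value form the
  two mixed derivatives agree at points \<open>z\<close> and \<open>y\<close> arbitrarily close to
  \<open>x\<close>. Continuity carries the equality to \<open>x\<close>.\<close>

lemma partial_deriv_commute:
  fixes f :: "real^'n::finite \<Rightarrow> real"
  assumes f: "smooth_on U f" and U: "open U" "x \<in> U"
  shows "partial_deriv i (partial_deriv j f) x = partial_deriv j (partial_deriv i f) x"
proof (rule ccontr)
  let ?A = "partial_deriv i (partial_deriv j f)" and ?B = "partial_deriv j (partial_deriv i f)"
  assume "?A x \<noteq> ?B x"
  \<comment> \<open>Values within less than half the gap of \<open>?A x\<close> and of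
    \<open>?B x\<close> respectively cannot coincide.\<close>
  then have pos: "\<bar>?A x - ?B x\<bar> / 2 > 0"
    by simp
  have cont: "isCont ?A x" "isCont ?B x"
    using smooth_on_partial_deriv[OF smooth_on_partial_deriv[OF f]] U
    by (meson smooth_on_imp_continuous_on continuous_on_eq_continuous_at)+
  obtain d1 where d1: "d1 > 0" "\<And>y. dist y x < d1 \<Longrightarrow> dist (?A y) (?A x) < \<bar>?A x - ?B x\<bar> / 2"
    using cont(1) pos unfolding continuous_at_eps_delta by blast
  obtain d2 where d2: "d2 > 0" "\<And>y. dist y x < d2 \<Longrightarrow> dist (?B y) (?B x) < \<bar>?A x - ?B x\<bar> / 2"
    using cont(2) pos unfolding continuous_at_eps_delta by blast
  obtain e where e: "e > 0" "ball x e \<subseteq> U"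
    using U by (meson open_contains_ball)
  \<comment> \<open>A third of the smallest radius, so that \<open>2 * t\<close> stays strictly
    below all three.\<close>
  define t where "t = min e (min d1 d2) / 3"
  have t: "t > 0" "2 * t < e" "2 * t < d1" "2 * t < d2"
    using d1(1) d2(1) e(1) by (auto simp: t_def)
  obtain y where y: "y \<in> ball x (2 * t)"
    "f (x + t *\<^sub>R axis i 1 + t *\<^sub>R axis j 1) - f (x + t *\<^sub>R axis i 1) - f (x + t *\<^sub>R axis j 1) + f x = t\<^sup>2 * ?B y"
    using second_difference_mvt[OF f U(1) e(2) t(1,2)] by metis
  obtain z where z: "z \<in> ball x (2 * t)"
    "f (x + t *\<^sub>R axis j 1 + t *\<^sub>R axis i 1) - f (x + t *\<^sub>R axis j 1) - f (x + t *\<^sub>R axis i 1) + f x = t\<^sup>2 * ?A z"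
    using second_difference_mvt[OF f U(1) e(2) t(1,2)] by metis
  have "t\<^sup>2 * ?A z = t\<^sup>2 * ?B y"
    using y(2) z(2) unfolding add.assoc add.commute[of "t *\<^sub>R axis i 1" "t *\<^sub>R axis j 1"] by linarith
  then have "?A z = ?B y"
    using t(1) by simp
  moreover have "dist (?A z) (?A x) < \<bar>?A x - ?B x\<bar> / 2" "dist (?B y) (?B x) < \<bar>?A x - ?B x\<bar> / 2"
    using d1(2)[of z] d2(2)[of y] y(1) z(1) t by (auto simp: dist_commute)
  ultimately show False
    by (auto simp: dist_real_def abs_if split: if_splits)
qed

section \<open>Inverse, Christoffel symbols and curvature of a two-dimensional metric\<close>

lemma matrix_inv_eqI:
  fixes A B :: "'a::field^'n^'n"
  assumes "A ** B = mat 1"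
  shows "matrix_inv A = B"
proof -
  have BA: "B ** A = mat 1"
    using assms by (simp add: matrix_left_right_inverse)
  \<comment> \<open>\<open>matrix_inv\<close> is a choice among two-sided inverses; \<open>B\<close>
    shows that there is one, and uniqueness of inverses then identifies the choice with
    \<open>B\<close>.\<close>
  have "A ** matrix_inv A = mat 1"
    unfolding matrix_inv_def using assms BA someI[of "\<lambda>C. A ** C = mat 1 \<and> C ** A = mat 1" B] by blast
  then show ?thesis
    by (metis BA matrix_mul_assoc matrix_mul_lid matrix_mul_rid)
qed

lemma matrix_inv_2:
  fixes A :: "real^2^2"
  assumes "det A \<noteq> 0"
  shows "matrix_inv A = vector [vector [A$2$2 / det A, - A$1$2 / det A], vector [- A$2$1 / det A, A$1$1 / det A]]"
proof -
  have "A$1$1 * A$2$2 / det A - A$1$2 * A$2$1 / det A = 1"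
    using assms by (simp add: diff_divide_distrib[symmetric]) (simp add: det_2)
  then show ?thesis
    by (intro matrix_inv_eqI)
      (simp add: vec_eq_iff forall_2 matrix_matrix_mult_def sum_2 mat_def mult.commute)
qed

text \<open>The quotient rule for the shape shared by all Christoffel symbols below:
  \<open>P\<close>, \<open>Q\<close>, \<open>R\<close> are the metric entries, \<open>M\<close> and
  \<open>N\<close> two of them, \<open>S\<close> and \<open>T\<close> first derivatives of entries.
  One factor 2 cancels against the squared denominator.\<close>

lemma partial_deriv_christoffel_form:
  fixes P Q R S T M N :: "real^'n::finite \<Rightarrow> real"
  assumes U: "open U" "x \<in> U"
    and "smooth_on U P" "smooth_on U Q" "smooth_on U R" "smooth_on U S" "smooth_on U T"
    and "smooth_on U M" "smooth_on U N"
    and nz: "P x * R x - Q x * Q x \<noteq> 0"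
  shows "partial_deriv i (\<lambda>y. (M y * S y - N y * T y) / (2 * (P y * R y - Q y * Q y))) x =
     ((partial_deriv i M x * S x + M x * partial_deriv i S x - partial_deriv i N x * T x - N x * partial_deriv i T x)
        * (P x * R x - Q x * Q x)
      - (M x * S x - N x * T x) * (partial_deriv i P x * R x + P x * partial_deriv i R x - 2 * Q x * partial_deriv i Q x))
     / (2 * (P x * R x - Q x * Q x)\<^sup>2)"
proof -
  have "((\<lambda>t. (M (x + t *\<^sub>R axis i 1) * S (x + t *\<^sub>R axis i 1) - N (x + t *\<^sub>R axis i 1) * T (x + t *\<^sub>R axis i 1))
       / (2 * (P (x + t *\<^sub>R axis i 1) * R (x + t *\<^sub>R axis i 1) - Q (x + t *\<^sub>R axis i 1) * Q (x + t *\<^sub>R axis i 1))))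
     has_real_derivative
     ((partial_deriv i M x * S x + M x * partial_deriv i S x - partial_deriv i N x * T x - N x * partial_deriv i T x)
        * (P x * R x - Q x * Q x)
      - (M x * S x - N x * T x) * (partial_deriv i P x * R x + P x * partial_deriv i R x - 2 * Q x * partial_deriv i Q x))
     / (2 * (P x * R x - Q x * Q x)\<^sup>2)) (at 0)"
    using nz by (auto intro!: derivative_eq_intros assms(3-9)[THEN smooth_on_has_partial_deriv, OF U]
        simp: divide_simps) (simp add: algebra_simps power2_eq_square)
  then show ?thesis
    unfolding partial_deriv_def[of i "\<lambda>y. (M y * S y - N y * T y) / (2 * (P y * R y - Q y * Q y))"]
    by (rule DERIV_imp_deriv)
qed

text \<open>The hypothesis \<open>closed\<close> says that locally the metric is a Hessian, without mentioning the
  potential.\<close>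

lemma scalar_curvature_hessian_type_2:
  fixes g :: "real^2 \<Rightarrow> real^2^2" and P Q R :: "real^2 \<Rightarrow> real"
  assumes U: "open U" "x \<in> U"
    and smooth: "smooth_on U P" "smooth_on U Q" "smooth_on U R"
    and g: "\<And>y. y \<in> U \<Longrightarrow> g y = vector [vector [P y, Q y], vector [Q y, R y]]"
    and nz: "\<And>y. y \<in> U \<Longrightarrow> det (g y) \<noteq> 0"
    and closed: "\<And>y. y \<in> U \<Longrightarrow> partial_deriv 2 P y = partial_deriv 1 Q y"
      "\<And>y. y \<in> U \<Longrightarrow> partial_deriv 2 Q y = partial_deriv 1 R y"
  shows "scalar_curvature g x =
    (P x * (partial_deriv 2 Q x * partial_deriv 1 R x - partial_deriv 1 Q x * partial_deriv 2 R x)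
     - partial_deriv 2 P x * (Q x * partial_deriv 1 R x - partial_deriv 1 Q x * R x)
     + partial_deriv 1 P x * (Q x * partial_deriv 2 R x - partial_deriv 2 Q x * R x)) / (2 * (det (g x))\<^sup>2)"
proof -
  \<comment> \<open>By \<open>closed\<close> the six first derivatives of the metric entries reduce
    to these four, which for a Hessian metric are the third derivatives of the potential.\<close>
  define a b c d where "a = partial_deriv 1 P" and "b = partial_deriv 1 Q"
    and "c = partial_deriv 1 R" and "d = partial_deriv 2 R"
  have smooth': "smooth_on U a" "smooth_on U b" "smooth_on U c" "smooth_on U d"
    using smooth by (simp_all add: a_def b_def c_def d_def smooth_on_partial_deriv)
  have pd: "partial_deriv 1 P y = a y" "partial_deriv 2 P y = b y" "partial_deriv 1 Q y = b y"
    "partial_deriv 2 Q y = c y" "partial_deriv 1 R y = c y" "partial_deriv 2 R y = d y" if "y \<in> U" for y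
    using closed[OF that] by (simp_all add: a_def b_def c_def d_def)
  \<comment> \<open>These relations among second derivatives of the metric, the fourth derivatives
    of a potential, make them cancel in the curvature.\<close>
  have pd2: "partial_deriv 2 a x = partial_deriv 1 b x" "partial_deriv 2 b x = partial_deriv 1 c x"
    "partial_deriv 2 c x = partial_deriv 1 d x"
    using partial_deriv_commute[OF smooth(1) U, of 2 1] partial_deriv_commute[OF smooth(2) U, of 2 1]
      partial_deriv_commute[OF smooth(3) U, of 2 1]
      partial_deriv_cong[OF U, of "partial_deriv 2 P" "partial_deriv 1 Q" 1]
      partial_deriv_cong[OF U, of "partial_deriv 2 Q" "partial_deriv 1 R" 1] closed
    by (simp_all add: a_def b_def c_def d_def)
  have det: "det (g y) = P y * R y - Q y * Q y" if "y \<in> U" for y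
    using g[OF that] by (simp add: det_2)
  have inv: "matrix_inv (g y) = vector [vector [R y / (P y * R y - Q y * Q y), - Q y / (P y * R y - Q y * Q y)],
      vector [- Q y / (P y * R y - Q y * Q y), P y / (P y * R y - Q y * Q y)]]" if "y \<in> U" for y
    using matrix_inv_2[OF nz[OF that]] unfolding det[OF that] by (simp add: g[OF that])
  have pdg: "partial_deriv l (\<lambda>y. g y $ 1 $ 1) y = partial_deriv l P y"
    "partial_deriv l (\<lambda>y. g y $ 1 $ 2) y = partial_deriv l Q y"
    "partial_deriv l (\<lambda>y. g y $ 2 $ 1) y = partial_deriv l Q y"
    "partial_deriv l (\<lambda>y. g y $ 2 $ 2) y = partial_deriv l R y" if "y \<in> U" for l y
    by (rule partial_deriv_cong[OF U(1) that]; simp add: g)+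
  \<comment> \<open>By symmetry the three derivatives in each bracket of \<open>christoffel\<close>
    are equal, so the bracket collapses to one of \<open>a\<close>, \<open>b\<close>,
    \<open>c\<close>, \<open>d\<close>.\<close>
  have chr: "christoffel g 1 1 1 y = (R y * a y - Q y * b y) / (2 * (P y * R y - Q y * Q y))"
    "christoffel g 1 1 2 y = (R y * b y - Q y * c y) / (2 * (P y * R y - Q y * Q y))"
    "christoffel g 1 2 1 y = (R y * b y - Q y * c y) / (2 * (P y * R y - Q y * Q y))"
    "christoffel g 1 2 2 y = (R y * c y - Q y * d y) / (2 * (P y * R y - Q y * Q y))"
    "christoffel g 2 1 1 y = (P y * b y - Q y * a y) / (2 * (P y * R y - Q y * Q y))"
    "christoffel g 2 1 2 y = (P y * c y - Q y * b y) / (2 * (P y * R y - Q y * Q y))"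
    "christoffel g 2 2 1 y = (P y * c y - Q y * b y) / (2 * (P y * R y - Q y * Q y))"
    "christoffel g 2 2 2 y = (P y * d y - Q y * c y) / (2 * (P y * R y - Q y * Q y))" if "y \<in> U" for y
    by (simp_all add: christoffel_def sum_2 inv that pdg[OF that] pd[OF that] diff_divide_distrib mult.commute[of _ 2])
  \<comment> \<open>Treating the reciprocal determinant as a variable removes all divisions by the
    determinant from the final identity.\<close>
  define e where "e = 1 / (P x * R x - Q x * Q x)"
  have e: "e * (P x * R x - Q x * Q x) = 1"
    using nz[OF U(2)] det[OF U(2)] by (simp add: e_def)
  have half: "X / (2 * (P x * R x - Q x * Q x)) = X * e / 2"
    "X / (2 * (P x * R x - Q x * Q x)\<^sup>2) = X * e\<^sup>2 / 2" for X
    by (simp_all add: e_def power_divide)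
  have "P x * R x - Q x * Q x \<noteq> 0"
    using e by auto
  note form = partial_deriv_christoffel_form[OF U smooth _ _ _ _ this]
  have pdchr:
    "partial_deriv l (christoffel g 1 1 1) x = partial_deriv l (\<lambda>y. (R y * a y - Q y * b y) / (2 * (P y * R y - Q y * Q y))) x"
    "partial_deriv l (christoffel g 1 1 2) x = partial_deriv l (\<lambda>y. (R y * b y - Q y * c y) / (2 * (P y * R y - Q y * Q y))) x"
    "partial_deriv l (christoffel g 1 2 1) x = partial_deriv l (\<lambda>y. (R y * b y - Q y * c y) / (2 * (P y * R y - Q y * Q y))) x"
    "partial_deriv l (christoffel g 1 2 2) x = partial_deriv l (\<lambda>y. (R y * c y - Q y * d y) / (2 * (P y * R y - Q y * Q y))) x"
    "partial_deriv l (christoffel g 2 1 1) x = partial_deriv l (\<lambda>y. (P y * b y - Q y * a y) / (2 * (P y * R y - Q y * Q y))) x"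
    "partial_deriv l (christoffel g 2 1 2) x = partial_deriv l (\<lambda>y. (P y * c y - Q y * b y) / (2 * (P y * R y - Q y * Q y))) x"
    "partial_deriv l (christoffel g 2 2 1) x = partial_deriv l (\<lambda>y. (P y * c y - Q y * b y) / (2 * (P y * R y - Q y * Q y))) x"
    "partial_deriv l (christoffel g 2 2 2) x = partial_deriv l (\<lambda>y. (P y * d y - Q y * c y) / (2 * (P y * R y - Q y * Q y))) x" for l
    by (rule partial_deriv_cong[OF U], simp only: chr)+
  have inv_x: "matrix_inv (g x) = vector [vector [R x * e, - Q x * e], vector [- Q x * e, P x * e]]"
    using inv[OF U(2)] by (simp add: e_def)
  \<comment> \<open>Every term of the curvature carries \<open>e ^ 3\<close>: one factor from the
    inverse metric, two from a differentiated symbol or a product of two symbols. Extending the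
    right-hand side by the determinant gives it the same power, so the identity holds with
    \<open>e\<close> as a free variable.\<close>
  have square: "X / (2 * (det (g x))\<^sup>2) = X * (P x * R x - Q x * Q x) * e ^ 3 / 2" for X
    using e by (simp add: det[OF U(2)] e_def power2_eq_square power3_eq_cube)
  show ?thesis
    unfolding square
    by (simp only: scalar_curvature_def sum_2 inv_x vector_2 pdchr form smooth smooth'
        chr[OF U(2)] pd[OF U(2)] pd2 half)
     (simp add: field_simps power2_eq_square power3_eq_cube)
qed

section \<open>The Fisher metric of an exponential family\<close>

lemma partial_deriv_ln_exp_density:
  fixes \<psi> :: "real^'n::finite \<Rightarrow> real"
  assumes "smooth_on U \<psi>" "open U" "\<theta> \<in> U"
  shows "partial_deriv j (\<lambda>\<eta>. ln (exp_density h k \<psi> \<eta> x)) \<theta> = h x $ j - partial_deriv j \<psi> \<theta>"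
proof -
  have "((\<lambda>t. (\<theta> + t *\<^sub>R axis j 1) \<bullet> h x + k x - \<psi> (\<theta> + t *\<^sub>R axis j 1)) has_real_derivative
      h x $ j - partial_deriv j \<psi> \<theta>) (at 0)"
    by (auto intro!: derivative_eq_intros smooth_on_has_partial_deriv assms
        simp: inner_add_left inner_axis inner_commute[of "axis j 1"])
  then show ?thesis
    unfolding exp_density_def ln_exp partial_deriv_def[of j "\<lambda>\<eta>. \<eta> \<bullet> h x + k x - \<psi> \<eta>"]
    by (rule DERIV_imp_deriv)
qed

text \<open>The first derivative is known on all of \<open>U\<close>, so it can be replaced inside
  the outer one; its term \<open>h x $ j\<close> does not depend on the parameter and
  vanishes.\<close>

lemma partial_deriv2_ln_exp_density:
  fixes \<psi> :: "real^'n::finite \<Rightarrow> real"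
  assumes "smooth_on U \<psi>" "open U" "\<theta> \<in> U"
  shows "partial_deriv i (partial_deriv j (\<lambda>\<eta>. ln (exp_density h k \<psi> \<eta> x))) \<theta>
    = - partial_deriv i (partial_deriv j \<psi>) \<theta>"
proof -
  have "partial_deriv i (partial_deriv j (\<lambda>\<eta>. ln (exp_density h k \<psi> \<eta> x))) \<theta>
      = partial_deriv i (\<lambda>\<eta>. h x $ j - partial_deriv j \<psi> \<eta>) \<theta>"
    using assms by (intro partial_deriv_cong[of U] partial_deriv_ln_exp_density)
  moreover have "((\<lambda>t. h x $ j - partial_deriv j \<psi> (\<theta> + t *\<^sub>R axis i 1)) has_real_derivative
      - partial_deriv i (partial_deriv j \<psi>) \<theta>) (at 0)"
    by (auto intro!: derivative_eq_intros smooth_on_has_partial_deriv smooth_on_partial_deriv assms)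
  ultimately show ?thesis
    by (simp add: partial_deriv_def[of i "\<lambda>\<eta>. h x $ j - partial_deriv j \<psi> \<eta>"] DERIV_imp_deriv)
qed

text \<open>The integrand is constant in the sample point, and normalization makes its integral
  equal to that constant.\<close>

lemma fisher_metric_eq_hessian:
  assumes "exponential_family \<Theta> h k \<psi>" "smooth_on \<Theta> \<psi>" "open \<Theta>" "\<theta> \<in> \<Theta>"
  shows "fisher_metric h k \<psi> \<theta> $ i $ j = partial_deriv i (partial_deriv j \<psi>) \<theta>"
proof -
  interpret prob_space "exp_measure h k \<psi> \<theta>"
    using assms by (simp add: exponential_family_def)
  show ?thesis
    by (simp add: fisher_metric_def partial_deriv2_ln_exp_density[OF assms(2-4)] prob_space)
qed

section \<open>The determinant formula for the curvature\<close>

theorem theorem3p2: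
  fixes \<Theta> :: "(real^2) set"
    and h :: "real^'m \<Rightarrow> real^2"
    and k :: "real^'m \<Rightarrow> real"
    and \<psi> :: "real^2 \<Rightarrow> real"
    and g :: "real^2 \<Rightarrow> real^2^2"
  assumes "open \<Theta>"
    and "exponential_family \<Theta> h k \<psi>"
    and "smooth_on \<Theta> \<psi>"
    and "g = fisher_metric h k \<psi>"
    and "\<forall>\<theta>\<in>\<Theta>. det (g \<theta>) \<noteq> 0"
  shows "\<forall>\<theta>\<in>\<Theta>.
    g \<theta> = vector
      [vector [partial_deriv 1 (partial_deriv 1 \<psi>) \<theta>, partial_deriv 1 (partial_deriv 2 \<psi>) \<theta>],
       vector [partial_deriv 2 (partial_deriv 1 \<psi>) \<theta>, partial_deriv 2 (partial_deriv 2 \<psi>) \<theta>]] \<and>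
    curvature g \<theta> =
      det (vector
        [vector [g \<theta> $ 1 $ 1, partial_deriv 2 (\<lambda>\<eta>. g \<eta> $ 1 $ 1) \<theta>, partial_deriv 1 (\<lambda>\<eta>. g \<eta> $ 1 $ 1) \<theta>],
         vector [g \<theta> $ 1 $ 2, partial_deriv 2 (\<lambda>\<eta>. g \<eta> $ 1 $ 2) \<theta>, partial_deriv 1 (\<lambda>\<eta>. g \<eta> $ 1 $ 2) \<theta>],
         vector [g \<theta> $ 2 $ 2, partial_deriv 2 (\<lambda>\<eta>. g \<eta> $ 2 $ 2) \<theta>, partial_deriv 1 (\<lambda>\<eta>. g \<eta> $ 2 $ 2) \<theta>]]
        :: real^3^3)
      / (4 * (det (vector [vector [g \<theta> $ 1 $ 1, g \<theta> $ 1 $ 2],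
                           vector [g \<theta> $ 2 $ 1, g \<theta> $ 2 $ 2]] :: real^2^2))\<^sup>2)"
proof
  fix \<theta> assume \<theta>: "\<theta> \<in> \<Theta>"
  let ?P = "partial_deriv 1 (partial_deriv 1 \<psi>)" and ?Q = "partial_deriv 1 (partial_deriv 2 \<psi>)"
    and ?R = "partial_deriv 2 (partial_deriv 2 \<psi>)"
  note smooth = smooth_on_partial_deriv[OF assms(3)]
  note smooth2 = smooth_on_partial_deriv[OF smooth]
  have comm: "partial_deriv 2 (partial_deriv 1 \<psi>) y = ?Q y" if "y \<in> \<Theta>" for y
    using partial_deriv_commute[OF assms(3,1) that] .
  have g: "g y = vector [vector [?P y, ?Q y], vector [?Q y, ?R y]]" if "y \<in> \<Theta>" for y
    using fisher_metric_eq_hessian[OF assms(2,3,1) that] comm[OF that]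
    by (simp add: assms(4) vec_eq_iff forall_2)
  \<comment> \<open>Symmetry of the third derivatives: the first equation exchanges the outer pair
    and then, on a neighbourhood, the inner pair; the second needs only the outer exchange.\<close>
  have closed: "partial_deriv 2 ?P y = partial_deriv 1 ?Q y" "partial_deriv 2 ?Q y = partial_deriv 1 ?R y"
    if "y \<in> \<Theta>" for y
    using partial_deriv_commute[OF smooth assms(1) that, of 2 1]
      partial_deriv_cong[OF assms(1) that, of "partial_deriv 2 (partial_deriv 1 \<psi>)" ?Q] comm by simp_all
  have pdg: "partial_deriv l (\<lambda>y. g y $ 1 $ 1) \<theta> = partial_deriv l ?P \<theta>"
    "partial_deriv l (\<lambda>y. g y $ 1 $ 2) \<theta> = partial_deriv l ?Q \<theta>"
    "partial_deriv l (\<lambda>y. g y $ 2 $ 2) \<theta> = partial_deriv l ?R \<theta>" for l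
    by (rule partial_deriv_cong[OF assms(1) \<theta>]; simp add: g)+
  have "curvature g \<theta> = scalar_curvature g \<theta> / 2"
    by (simp add: curvature_def)
  \<comment> \<open>The numerator supplied here is the 3 by 3 determinant expanded along its first
    row; division by the dimension turns the factor 2 in the denominator into 4.\<close>
  also note scalar_curvature_hessian_type_2[OF assms(1) \<theta> smooth2 smooth2 smooth2 g _ closed]
  finally show "g \<theta> = vector
      [vector [partial_deriv 1 (partial_deriv 1 \<psi>) \<theta>, partial_deriv 1 (partial_deriv 2 \<psi>) \<theta>],
       vector [partial_deriv 2 (partial_deriv 1 \<psi>) \<theta>, partial_deriv 2 (partial_deriv 2 \<psi>) \<theta>]] \<and>
    curvature g \<theta> =
      det (vector
        [vector [g \<theta> $ 1 $ 1, partial_deriv 2 (\<lambda>\<eta>. g \<eta> $ 1 $ 1) \<theta>, partial_deriv 1 (\<lambda>\<eta>. g \<eta> $ 1 $ 1) \<theta>],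
         vector [g \<theta> $ 1 $ 2, partial_deriv 2 (\<lambda>\<eta>. g \<eta> $ 1 $ 2) \<theta>, partial_deriv 1 (\<lambda>\<eta>. g \<eta> $ 1 $ 2) \<theta>],
         vector [g \<theta> $ 2 $ 2, partial_deriv 2 (\<lambda>\<eta>. g \<eta> $ 2 $ 2) \<theta>, partial_deriv 1 (\<lambda>\<eta>. g \<eta> $ 2 $ 2) \<theta>]]
        :: real^3^3)
      / (4 * (det (vector [vector [g \<theta> $ 1 $ 1, g \<theta> $ 1 $ 2],
                           vector [g \<theta> $ 2 $ 1, g \<theta> $ 2 $ 2]] :: real^2^2))\<^sup>2)"
    using assms(5) \<theta> by (simp add: det_2 det_3 g comm pdg algebra_simps)
qed

end
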